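(* Let $\Phi$ be a set with a semiflow $\varrho^{(t)}:\Phi\to\Phi$, $t\in\mathbb Z^+$, and let $L_t:\Phi\to\mathbb R^{m\times m}$, $t\in\mathbb Z^+$, be matrix-valued maps defining the generalized matrix sequence map $\mathcal L(t_0,\phi)=\{L_{t+t_0}(\varrho^{(t)}\phi)\}_{t\in\mathbb Z^+}$. Suppose $\mathcal L(t_0,\phi)\subset\mathcal H$ for all $t_0\ge0$ and $\phi\in\Phi$, where $\mathcal H\subset\mathbb R^{m\times m}$ is the class of matrices all of whose row sums are equal to each other. Then $$\hat\rho(\mathcal L,\phi)=\operatorname{diam}(\mathcal L,\phi).$$
   Context: $\mathbb Z^+=\{0,1,2,\dots\}$. In the paper $\{\Phi,\mathcal B,P,\varrho^{(t)}\}$ is a random dynamical system ($\mathcal B$ a $\sigma$-algebra, $P$ a probability measure on $\Phi$, $\varrho^{(t)}$ a semiflow, i.e. $\varrho^{(t+s)}=\varrho^{(t)}\circ\varrho^{(s)}$, $\varrho^{(0)}=\mathrm{id}$). $\prod$ is the left matrix product $\prod_{k=a}^bA_k=A_b\cdots A_a$. Hajnal diameter: for a matrix $L$ with rows $g_1,\dots,g_m$ and a vector norm, $\operatorname{diam}(L)=\max_{i,j}\|g_i-g_j\|$, and $$\operatorname{diam}(\mathcal L,\phi)=\limsup_{t\to\infty}\sup_{t_0\ge0}\Big\{\operatorname{diam}\Big(\prod_{k=t_0}^{t_0+t-1}L_k(\varrho^{(k-t_0)}\phi)\Big)\Big\}^{1/t}$$ (independent of the norm). Projection: let $\mathcal E_0$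 be the span of $e_0=[1,1,\dots,1]^\top$ and $P$ any $(m-1)\times m$ matrix with kernel exactly $\mathcal E_0$. For $L\in\mathcal H$, the (skew) projection $\hat L\in\mathbb R^{(m-1)\times(m-1)}$ is the unique solution of $PL=\hat LP$. The projection joint spectral radius is $$\hat\rho(\mathcal L,\phi)=\limsup_{t\to\infty}\sup_{t_0\ge0}\Big\|\prod_{k=t_0}^{t_0+t-1}\hat L_k(\varrho^{(k-t_0)}\phi)\Big\|^{1/t},$$ where $\|\cdot\|$ is a matrix norm induced by a vector norm. *)

theory Defs
  imports
    "Jordan_Normal_Form.Matrix_Kernel"
    "HOL-Library.Extended_Real"
begin

definition vector_norm :: "nat \<Rightarrow> (real vec \<Rightarrow> real) \<Rightarrow> bool" where
  "vector_norm n N \<longleftrightarrow>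
     (\<forall>x\<in>carrier_vec n. 0 \<le> N x \<and> (N x = 0 \<longleftrightarrow> x = 0\<^sub>v n)) \<and>
     (\<forall>c. \<forall>x\<in>carrier_vec n. N (c \<cdot>\<^sub>v x) = \<bar>c\<bar> * N x) \<and>
     (\<forall>x\<in>carrier_vec n. \<forall>y\<in>carrier_vec n. N (x + y) \<le> N x + N y)"

text \<open>The supremum is over the unit ball rather than the unit sphere, so that the
  set is nonempty also for \<open>n = 0\<close>; then the norm is 0.\<close>

definition induced_matrix_norm :: "nat \<Rightarrow> (real vec \<Rightarrow> real) \<Rightarrow> real mat \<Rightarrow> real" where
  "induced_matrix_norm n N A = (SUP x\<in>{x \<in> carrier_vec n. N x \<le> 1}. N (A *\<^sub>v x))"

definition semiflow_on :: "'s set \<Rightarrow> (nat \<Rightarrow> 's \<Rightarrow> 's) \<Rightarrow> bool" where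
  "semiflow_on \<Phi> \<rho> \<longleftrightarrow>
     (\<forall>t. \<forall>\<phi>\<in>\<Phi>. \<rho> t \<phi> \<in> \<Phi>) \<and>
     (\<forall>\<phi>\<in>\<Phi>. \<rho> 0 \<phi> = \<phi>) \<and>
     (\<forall>s t. \<forall>\<phi>\<in>\<Phi>. \<rho> (t + s) \<phi> = \<rho> t (\<rho> s \<phi>))"

definition mat_seq_map ::
  "(nat \<Rightarrow> 's \<Rightarrow> real mat) \<Rightarrow> (nat \<Rightarrow> 's \<Rightarrow> 's) \<Rightarrow> nat \<Rightarrow> 's \<Rightarrow> nat \<Rightarrow> real mat" where
  "mat_seq_map L \<rho> t\<^sub>0 \<phi> t = L (t + t\<^sub>0) (\<rho> t \<phi>)"

definition equal_row_sum_mats :: "nat \<Rightarrow> real mat set" where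
  "equal_row_sum_mats m =
     {A \<in> carrier_mat m m. \<forall>i<m. \<forall>j<m. (\<Sum>k<m. A $$ (i, k)) = (\<Sum>k<m. A $$ (j, k))}"

text \<open>\<open>left_mat_prod n A a t\<close> is the product \<open>A (a + t - 1) * \<dots> * A (a + 1) * A a\<close>
  of \<open>n \<times> n\<close> matrices, with later factors on the left.\<close>

primrec left_mat_prod :: "nat \<Rightarrow> (nat \<Rightarrow> real mat) \<Rightarrow> nat \<Rightarrow> nat \<Rightarrow> real mat" where
  "left_mat_prod n A a 0 = 1\<^sub>m n"
| "left_mat_prod n A a (Suc t) = A (a + t) * left_mat_prod n A a t"

definition mat_diam :: "(real vec \<Rightarrow> real) \<Rightarrow> real mat \<Rightarrow> real" where
  "mat_diam N A =
     Max ((\<lambda>(i, j). N (row A i - row A j)) ` ({..<dim_row A} \<times> {..<dim_row A}))"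

text \<open>No boundedness of the matrices \<open>L k \<psi>\<close> is assumed, so the supremum over \<open>t\<^sub>0\<close> and
  the limit superior are taken in the extended reals.\<close>

definition hajnal_diameter ::
  "nat \<Rightarrow> (real vec \<Rightarrow> real) \<Rightarrow> (nat \<Rightarrow> 's \<Rightarrow> real mat) \<Rightarrow> (nat \<Rightarrow> 's \<Rightarrow> 's) \<Rightarrow> 's \<Rightarrow> ereal" where
  "hajnal_diameter m N L \<rho> \<phi> =
     limsup (\<lambda>t. SUP t\<^sub>0.
       ereal (mat_diam N (left_mat_prod m (\<lambda>k. L k (\<rho> (k - t\<^sub>0) \<phi>)) t\<^sub>0 t)
                powr (1 / real t)))"

definition ones_vec :: "nat \<Rightarrow> real vec" where
  "ones_vec m = vec m (\<lambda>_. 1)"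

definition synchronization_space :: "nat \<Rightarrow> real vec set" where
  "synchronization_space m =
     LinearCombinations.module.span class_ring (module_vec TYPE(real) m) {ones_vec m}"

definition sync_projection :: "nat \<Rightarrow> real mat \<Rightarrow> bool" where
  "sync_projection m P \<longleftrightarrow>
     P \<in> carrier_mat (m - 1) m \<and> mat_kernel P = synchronization_space m"

definition skew_projection :: "nat \<Rightarrow> real mat \<Rightarrow> real mat \<Rightarrow> real mat" where
  "skew_projection m P A = (THE B. B \<in> carrier_mat (m - 1) (m - 1) \<and> P * A = B * P)"

definition projection_jsr ::
  "nat \<Rightarrow> real mat \<Rightarrow> (real vec \<Rightarrow> real) \<Rightarrow> (nat \<Rightarrow> 's \<Rightarrow> real mat) \<Rightarrow> (nat \<Rightarrow> 's \<Rightarrow> 's) \<Rightarrow>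
   's \<Rightarrow> ereal" where
  "projection_jsr m P N L \<rho> \<phi> =
     limsup (\<lambda>t. SUP t\<^sub>0.
       ereal (induced_matrix_norm (m - 1) N
                (left_mat_prod (m - 1) (\<lambda>k. skew_projection m P (L k (\<rho> (k - t\<^sub>0) \<phi>))) t\<^sub>0 t)
                powr (1 / real t)))"

lemma synchronization_space_eq:
  "synchronization_space m = {c \<cdot>\<^sub>v ones_vec m | c. True}"
proof -
  interpret vec_space "TYPE(real)" m .
  have c: "ones_vec m \<in> carrier_vec m" by (simp add: ones_vec_def)
  have lc: "lincomb a {ones_vec m} = a (ones_vec m) \<cdot>\<^sub>v ones_vec m" for a
    using c by (simp add: lincomb_def)
  have "v \<in> span {ones_vec m} \<longleftrightarrow> (\<exists>c. v = c \<cdot>\<^sub>v ones_vec m)" for v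
  proof
    assume "v \<in> span {ones_vec m}"
    then obtain a where "v = lincomb a {ones_vec m}"
      using finite_span[of "{ones_vec m}"] c by auto
    then show "\<exists>c. v = c \<cdot>\<^sub>v ones_vec m" using lc by blast
  next
    assume "\<exists>c. v = c \<cdot>\<^sub>v ones_vec m"
    then obtain c' where "v = c' \<cdot>\<^sub>v ones_vec m" by blast
    then have "v = lincomb (\<lambda>_. c') {ones_vec m}" using lc by simp
    then show "v \<in> span {ones_vec m}"
      using finite_span[of "{ones_vec m}"] c by auto
  qed
  then have "span {ones_vec m} = {c \<cdot>\<^sub>v ones_vec m | c. True}" by (simp add: set_eq_iff)
  then show ?thesis unfolding synchronization_space_def .
qed

lemma sync_projection_right_inverse:
  assumes m: "1 \<le> m" and P: "sync_projection m P"
  obtains Q where "Q \<in> carrier_mat m (m - 1)" "P * Q = 1\<^sub>m (m - 1)"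
proof -
  have Pc: "P \<in> carrier_mat (m - 1) m" and K: "mat_kernel P = {c \<cdot>\<^sub>v ones_vec m | c. True}"
    using P synchronization_space_eq[of m] by (auto simp: sync_projection_def)
  define M where "M = mat m m (\<lambda>(i, j). if i < m - 1 then P $$ (i, j) else if j = 0 then 1 else 0)"
  have M: "M \<in> carrier_mat m m" by (simp add: M_def)
  have rowM: "row M i = row P i" if "i < m - 1" for i
    using that Pc by (intro eq_vecI) (auto simp: M_def)
  have rowM': "row M (m - 1) = unit_vec m 0"
    using m by (intro eq_vecI) (auto simp: M_def unit_vec_def)
  have "det M \<noteq> 0"
  proof
    assume "det M = 0"
    then obtain v where v: "v \<in> carrier_vec m" "v \<noteq> 0\<^sub>v m" and Mv: "M *\<^sub>v v = 0\<^sub>v m"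
      using det_0_iff_vec_prod_zero_field[OF M] by auto
    have e: "row M i \<bullet> v = 0" if "i < m" for i
      using arg_cong[OF Mv, of "\<lambda>u. u $ i"] that M by (simp add: mult_mat_vec_def)
    have "P *\<^sub>v v = 0\<^sub>v (m - 1)"
    proof (rule eq_vecI)
      fix i assume "i < dim_vec (0\<^sub>v (m - 1) :: real vec)"
      then have i: "i < m - 1" by simp
      show "(P *\<^sub>v v) $ i = 0\<^sub>v (m - 1) $ i"
        using e[of i] rowM[OF i] i Pc by simp
    qed (use Pc in simp)
    then have "v \<in> mat_kernel P" using v Pc by (intro mat_kernelI)
    then obtain c where c: "v = c \<cdot>\<^sub>v ones_vec m" using K by auto
    have "v $ 0 = 0" using e[of "m - 1"] m v unfolding rowM' by simp
    then have "c = 0" using c m by (simp add: ones_vec_def)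
    then have "v = 0\<^sub>v m" using c by (intro eq_vecI) (auto simp: ones_vec_def)
    then show False using v by simp
  qed
  from det_non_zero_imp_unit[OF M this, of "()"]
  obtain N where N: "N \<in> carrier_mat m m" and MN: "M * N = 1\<^sub>m m"
    by (auto simp: Units_def ring_mat_def)
  define Q where "Q = mat m (m - 1) (\<lambda>(i, j). N $$ (i, j))"
  have Q: "Q \<in> carrier_mat m (m - 1)" by (simp add: Q_def)
  have colQ: "col Q j = col N j" if "j < m - 1" for j
    using that N by (intro eq_vecI) (auto simp: Q_def)
  have "P * Q = 1\<^sub>m (m - 1)"
  proof (rule eq_matI)
    fix i j assume "i < dim_row (1\<^sub>m (m - 1) :: real mat)" "j < dim_col (1\<^sub>m (m - 1) :: real mat)"
    then have ij: "i < m - 1" "j < m - 1" by auto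
    have "(P * Q) $$ (i, j) = row M i \<bullet> col N j"
      using ij Pc Q rowM colQ by simp
    also have "\<dots> = (M * N) $$ (i, j)" using ij M N by simp
    finally show "(P * Q) $$ (i, j) = 1\<^sub>m (m - 1) $$ (i, j)" using ij by (simp add: MN)
  qed (use Pc Q in auto)
  with Q show thesis by (rule that)
qed

lemma equal_row_sum_mult_ones:
  assumes m: "1 \<le> m" and A: "A \<in> equal_row_sum_mats m"
  shows "\<exists>r. A *\<^sub>v ones_vec m = r \<cdot>\<^sub>v ones_vec m"
proof (intro exI eq_vecI)
  have Ac: "A \<in> carrier_mat m m"
    and rows: "\<forall>i<m. \<forall>j<m. (\<Sum>k<m. A $$ (i, k)) = (\<Sum>k<m. A $$ (j, k))"
    using A unfolding equal_row_sum_mats_def by blast+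
  show "dim_vec (A *\<^sub>v ones_vec m) = dim_vec ((\<Sum>k<m. A $$ (0, k)) \<cdot>\<^sub>v ones_vec m)"
    using Ac by (simp add: ones_vec_def)
  fix i assume "i < dim_vec ((\<Sum>k<m. A $$ (0, k)) \<cdot>\<^sub>v ones_vec m)"
  then have i: "i < m" by (simp add: ones_vec_def)
  have "(A *\<^sub>v ones_vec m) $ i = (\<Sum>k<m. A $$ (i, k))"
    using i Ac by (simp add: ones_vec_def scalar_prod_def lessThan_atLeast0)
  also have "\<dots> = (\<Sum>k<m. A $$ (0, k))"
    using rows[rule_format, OF i, of 0] m by linarith
  finally show "(A *\<^sub>v ones_vec m) $ i = ((\<Sum>k<m. A $$ (0, k)) \<cdot>\<^sub>v ones_vec m) $ i"
    using i by (simp add: ones_vec_def)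
qed

lemma skew_projection_ex1:
  assumes m: "1 \<le> m" and P: "sync_projection m P" and A: "A \<in> equal_row_sum_mats m"
  shows "\<exists>!B. B \<in> carrier_mat (m - 1) (m - 1) \<and> P * A = B * P"
proof -
  have Pc: "P \<in> carrier_mat (m - 1) m" and K: "mat_kernel P = {c \<cdot>\<^sub>v ones_vec m | c. True}"
    using P synchronization_space_eq[of m] by (auto simp: sync_projection_def)
  have Ac: "A \<in> carrier_mat m m" using A unfolding equal_row_sum_mats_def by blast
  obtain Q where Q: "Q \<in> carrier_mat m (m - 1)" and PQ: "P * Q = 1\<^sub>m (m - 1)"
    using sync_projection_right_inverse[OF m P] .
  obtain r where r: "A *\<^sub>v ones_vec m = r \<cdot>\<^sub>v ones_vec m"
    using equal_row_sum_mult_ones[OF m A] by blast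
  have o: "ones_vec m \<in> carrier_vec m" by (simp add: ones_vec_def)
  have PAK: "P *\<^sub>v (A *\<^sub>v v) = 0\<^sub>v (m - 1)" if vK: "v \<in> mat_kernel P" for v
  proof -
    obtain c where "v = c \<cdot>\<^sub>v ones_vec m" using vK K by auto
    then have "A *\<^sub>v v = (c * r) \<cdot>\<^sub>v ones_vec m"
      using mult_mat_vec[OF Ac o, of c] r by (simp add: smult_smult_assoc)
    then have "A *\<^sub>v v \<in> mat_kernel P" using K by auto
    then show ?thesis using mat_kernelD[OF Pc] by blast
  qed
  have QP: "Q * P \<in> carrier_mat m m" and PA: "P * A \<in> carrier_mat (m - 1) m"
    and PAQ: "P * A * Q \<in> carrier_mat (m - 1) (m - 1)" using Q Pc Ac by auto
  have "P * A = P * A * Q * P"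
  proof (rule eq_matI)
    fix i j assume "i < dim_row (P * A * Q * P)" "j < dim_col (P * A * Q * P)"
    then have ij: "i < m - 1" "j < m" using Pc by auto
    let ?e = "unit_vec m j :: real vec"
    have e: "?e \<in> carrier_vec m" by simp
    let ?w = "(Q * P) *\<^sub>v ?e"
    have w: "?w \<in> carrier_vec m" using QP e by (rule mult_mat_vec_carrier)
    have "P *\<^sub>v ?w = P * (Q * P) *\<^sub>v ?e"
      using assoc_mult_mat_vec[OF Pc QP e] by simp
    also have "P * (Q * P) = P"
      using assoc_mult_mat[OF Pc Q Pc] PQ Pc by simp
    finally have Pw: "P *\<^sub>v ?w = P *\<^sub>v ?e" .
    have "P *\<^sub>v (?w - ?e) = 0\<^sub>v (m - 1)"
      using mult_minus_distrib_mat_vec[OF Pc w e] Pw Pc by simp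
    then have "?w - ?e \<in> mat_kernel P" using w by (intro mat_kernelI[OF Pc]) auto
    from PAK[OF this] have "(P * A) *\<^sub>v (?w - ?e) = 0\<^sub>v (m - 1)"
      using assoc_mult_mat_vec[OF Pc Ac, of "?w - ?e"] w by simp
    then have z: "(P * A) *\<^sub>v ?w - (P * A) *\<^sub>v ?e = 0\<^sub>v (m - 1)"
      using mult_minus_distrib_mat_vec[OF PA w e] by simp
    have "((P * A) *\<^sub>v ?w) $ i = ((P * A) *\<^sub>v ?e) $ i"
      using arg_cong[OF z, of "\<lambda>u. u $ i"] ij Pc by simp
    moreover have "(P * A) *\<^sub>v ?w = (P * A * Q * P) *\<^sub>v ?e"
      using assoc_mult_mat_vec[OF PA QP e] assoc_mult_mat[OF PA Q Pc] by simp
    ultimately have "((P * A) *\<^sub>v ?e) $ i = ((P * A * Q * P) *\<^sub>v ?e) $ i" by simp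
    moreover have "(X *\<^sub>v ?e) $ i = X $$ (i, j)" if "X \<in> carrier_mat (m - 1) m" for X :: "real mat"
      using that ij by simp
    moreover have "P * A * Q * P \<in> carrier_mat (m - 1) m" using PAQ Pc by (rule mult_carrier_mat)
    ultimately show "(P * A) $$ (i, j) = (P * A * Q * P) $$ (i, j)" using PA by metis
  qed (use Pc Ac in auto)
  moreover have "B = P * A * Q" if "B \<in> carrier_mat (m - 1) (m - 1)" "P * A = B * P" for B
    using assoc_mult_mat[OF that(1) Pc Q] that PQ by simp
  ultimately show ?thesis using PAQ by blast
qed

end

theory Submission
  imports "HOL-Analysis.Extended_Real_Limits" Defs
begin

text \<open>If \<open>P * A = B * P\<close>, then the entries of \<open>B\<close> are linear in the differences of the rows of \<open>A\<close>,
  because the rows of \<open>P\<close> sum to 0, and conversely those differences are linear in the entries of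
  \<open>B\<close>, because the kernel of \<open>P\<close> consists of the constant vectors. As norms in finite dimension are
  equivalent, \<open>mat_diam N A\<close> and the norm of \<open>B\<close> agree up to a constant factor \<open>c\<close> independent
  of \<open>A\<close>. Products of the \<open>L k\<close> and of their projections are again such a pair, and
  \<open>c powr (1 / t)\<close> tends to 1.\<close>

unbundle no vec_syntax

section \<open>Roots, suprema and limits superior\<close>

text \<open>A uniform constant factor disappears under \<open>t\<close>-th roots. One direction
  suffices: equality follows by applying it twice with \<open>f\<close> and \<open>g\<close>
  exchanged.\<close>

lemma limsup_SUP_powr_mono:
  fixes f g :: "nat \<Rightarrow> 'i \<Rightarrow> real"
  assumes c: "0 < c"
    and f: "\<And>t s. 0 \<le> f t s" and g: "\<And>t s. 0 \<le> g t s"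
    and le: "\<And>t s. f t s \<le> c * g t s"
  shows "limsup (\<lambda>t. SUP s. ereal (f t s powr (1 / real t)))
    \<le> limsup (\<lambda>t. SUP s. ereal (g t s powr (1 / real t)))"
proof -
  let ?F = "\<lambda>t. SUP s. ereal (f t s powr (1 / real t))"
  let ?G = "\<lambda>t. SUP s. ereal (g t s powr (1 / real t))"
  have "(\<lambda>t. c powr (1 / real t)) \<longlonglongrightarrow> c powr 0"
    using c by (intro tendsto_intros lim_1_over_n) simp
  then have lim: "(\<lambda>t. ereal (c powr (1 / real t))) \<longlonglongrightarrow> 1"
    using c by (simp add: one_ereal_def)
  \<comment> \<open>This also covers \<open>t = 0\<close>, where \<open>1 / real 0 = 0\<close> and
    \<open>x powr 0\<close> is 1, or 0 if \<open>x = 0\<close>.\<close>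
  have "?F t \<le> ereal (c powr (1 / real t)) * ?G t" for t
  proof (rule SUP_least)
    fix s
    have "f t s powr (1 / real t) \<le> (c * g t s) powr (1 / real t)"
      using f le by (intro powr_mono2) auto
    also have "\<dots> = c powr (1 / real t) * g t s powr (1 / real t)"
      using c g by (simp add: powr_mult)
    finally have "ereal (f t s powr (1 / real t))
        \<le> ereal (c powr (1 / real t)) * ereal (g t s powr (1 / real t))" by simp
    also have "\<dots> \<le> ereal (c powr (1 / real t)) * ?G t"
      by (intro ereal_mult_left_mono SUP_upper) auto
    finally show "ereal (f t s powr (1 / real t)) \<le> ereal (c powr (1 / real t)) * ?G t" .
  qed
  then have "limsup ?F \<le> limsup (\<lambda>t. ereal (c powr (1 / real t)) * ?G t)"
    by (intro Limsup_mono always_eventually allI)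
  \<comment> \<open>The limit of the first factor is positive and finite, so the product rule holds
    even if \<open>?G\<close> or its limsup is infinite.\<close>
  also have "\<dots> = 1 * limsup ?G"
    using lim by (intro ereal_limsup_lim_mult) auto
  finally show ?thesis by simp
qed

section \<open>Equivalence of norms in finite dimension\<close>

text \<open>Bolzano-Weierstrass by induction on the number of coordinates: each new coordinate is
  made monotone along a further subsequence, hence convergent by boundedness, and the earlier
  coordinates stay convergent.\<close>

lemma bounded_coordinates_convergent_subseq:
  fixes f :: "nat \<Rightarrow> nat \<Rightarrow> real"
  assumes "\<And>k i. i < n \<Longrightarrow> \<bar>f k i\<bar> \<le> b"
  shows "\<exists>r. strict_mono r \<and> (\<forall>i<n. convergent (\<lambda>k. f (r k) i))"
  using assms
proof (induction n)
  case 0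
  show ?case by (intro exI[of _ id]) (simp add: strict_mono_def)
next
  case (Suc n)
  then obtain r where r: "strict_mono r" "\<forall>i<n. convergent (\<lambda>k. f (r k) i)"
    by (meson less_SucI)
  obtain q where q: "strict_mono q" "monoseq (\<lambda>k. f (r (q k)) n)"
    using seq_monosub[of "\<lambda>k. f (r k) n"] by auto
  have "Bseq (\<lambda>k. f (r (q k)) n)"
    using Suc.prems by (intro BseqI'[of _ b]) simp
  then have "convergent (\<lambda>k. f (r (q k)) n)"
    using q(2) by (rule Bseq_monoseq_convergent)
  moreover have "convergent (\<lambda>k. f (r (q k)) i)" if "i < n" for i
    using r(2) that convergent_subseq_convergent[OF _ q(1), of "\<lambda>k. f (r k) i"] by (simp add: o_def)
  ultimately show ?case
    using r(1) q(1) by (intro exI[of _ "\<lambda>k. r (q k)"]) (auto simp: less_Suc_eq strict_mono_def)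
qed

lemma vector_norm_ge_0: "vector_norm n N \<Longrightarrow> x \<in> carrier_vec n \<Longrightarrow> 0 \<le> N x"
  and vector_norm_eq_0: "vector_norm n N \<Longrightarrow> x \<in> carrier_vec n \<Longrightarrow> N x = 0 \<longleftrightarrow> x = 0\<^sub>v n"
  and vector_norm_smult: "vector_norm n N \<Longrightarrow> x \<in> carrier_vec n \<Longrightarrow> N (c \<cdot>\<^sub>v x) = \<bar>c\<bar> * N x"
  and vector_norm_triangle:
    "vector_norm n N \<Longrightarrow> x \<in> carrier_vec n \<Longrightarrow> y \<in> carrier_vec n \<Longrightarrow> N (x + y) \<le> N x + N y"
  by (auto simp: vector_norm_def)

text \<open>Triangle inequality for the expansion in unit vectors. It yields the upper bound on
  \<open>N\<close> and also serves below as continuity of \<open>N\<close> with respect to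
  coordinates.\<close>

lemma vector_norm_le_coordinates:
  assumes N: "vector_norm n N" and x: "x \<in> carrier_vec n"
  shows "N x \<le> (\<Sum>i<n. \<bar>x $ i\<bar> * N (unit_vec n i))"
proof -
  \<comment> \<open>\<open>y j\<close> keeps the first \<open>j\<close> coordinates, so each
    induction step adds one multiple of a unit vector.\<close>
  define y where "y j = vec n (\<lambda>i. if i < j then x $ i else 0)" for j
  have y: "y j \<in> carrier_vec n" for j by (simp add: y_def)
  have "N (y j) \<le> (\<Sum>i<j. \<bar>x $ i\<bar> * N (unit_vec n i))" if "j \<le> n" for j
    using that
  proof (induction j)
    case 0
    have "y 0 = 0\<^sub>v n" by (auto simp: y_def)
    then show ?case using vector_norm_eq_0[OF N, of "0\<^sub>v n"] by simp
  next
    case (Suc j)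
    have "y (Suc j) = y j + x $ j \<cdot>\<^sub>v unit_vec n j"
      using Suc.prems by (intro eq_vecI) (auto simp: y_def unit_vec_def less_Suc_eq)
    then have "N (y (Suc j)) \<le> N (y j) + N (x $ j \<cdot>\<^sub>v unit_vec n j)"
      using vector_norm_triangle[OF N y] by simp
    then show ?case using Suc vector_norm_smult[OF N, of "unit_vec n j"] by simp
  qed
  moreover have "y n = x" using x by (intro eq_vecI) (auto simp: y_def)
  ultimately show ?thesis by force
qed

text \<open>The case \<open>n = 0\<close> shapes the form: \<open>b\<close> is required to be
  nonnegative since no coordinate forces it, and \<open>1\<close> is added to a possibly empty sum
  to keep the constant positive.\<close>

lemma vector_norm_upper_bound:
  assumes N: "vector_norm n N"
  obtains c where "0 < c"
    "\<And>x b. x \<in> carrier_vec n \<Longrightarrow> 0 \<le> b \<Longrightarrow> (\<And>i. i < n \<Longrightarrow> \<bar>x $ i\<bar> \<le> b) \<Longrightarrow> N x \<le> c * b"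
proof
  let ?S = "\<Sum>i<n. N (unit_vec n i)"
  have e: "0 \<le> N (unit_vec n i)" for i using vector_norm_ge_0[OF N] by simp
  show "0 < ?S + 1" using e by (simp add: sum_nonneg add_nonneg_pos)
  fix x and b :: real
  assume x: "x \<in> carrier_vec n" and b: "0 \<le> b" and le: "\<And>i. i < n \<Longrightarrow> \<bar>x $ i\<bar> \<le> b"
  have "N x \<le> (\<Sum>i<n. b * N (unit_vec n i))"
    using le e by (intro order.trans[OF vector_norm_le_coordinates[OF N x]] sum_mono mult_right_mono) auto
  also have "\<dots> \<le> (?S + 1) * b"
    using b by (simp add: sum_distrib_left[symmetric] algebra_simps)
  finally show "N x \<le> (?S + 1) * b" .
qed

text \<open>Sequential compactness: otherwise some vectors with largest coordinate 1 and norm tending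
  to 0 would converge to a nonzero vector of norm 0.\<close>

lemma vector_norm_coordinate_bound:
  assumes N: "vector_norm n N"
  obtains c where "0 < c" "\<And>x i. x \<in> carrier_vec n \<Longrightarrow> i < n \<Longrightarrow> \<bar>x $ i\<bar> \<le> c * N x"
proof -
  \<comment> \<open>With the candidate constants \<open>Suc k\<close>, the negation gives a sequence
    of counterexamples indexed by \<open>k\<close>.\<close>
  have "\<exists>k. \<forall>x\<in>carrier_vec n. \<forall>i<n. \<bar>x $ i\<bar> \<le> real (Suc k) * N x"
  proof (rule ccontr)
    assume "\<nexists>k. \<forall>x\<in>carrier_vec n. \<forall>i<n. \<bar>x $ i\<bar> \<le> real (Suc k) * N x"
    then have "\<forall>k. \<exists>x i. x \<in> carrier_vec n \<and> i < n \<and> real (Suc k) * N x < \<bar>x $ i\<bar>"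
      by (meson not_le)
    then obtain x i where x: "\<And>k. x k \<in> carrier_vec n" and i: "\<And>k. i k < n"
      and lt: "\<And>k. real (Suc k) * N (x k) < \<bar>x k $ i k\<bar>" by metis
    define M where "M k = Max ((\<lambda>i. \<bar>x k $ i\<bar>) ` {..<n})" for k
    have n: "0 < n" using i[of 0] by simp
    have M: "\<bar>x k $ j\<bar> \<le> M k" if "j < n" for j k
      unfolding M_def using that by (intro Max_ge) auto
    have Mpos: "0 < M k" for k
    proof -
      have "0 \<le> real (Suc k) * N (x k)" using vector_norm_ge_0[OF N x] by simp
      also note lt
      also have "\<bar>x k $ i k\<bar> \<le> M k" using M i by simp
      finally show ?thesis .
    qed
    define y where "y k = (1 / M k) \<cdot>\<^sub>v x k" for k
    have y: "y k \<in> carrier_vec n" for k using x by (simp add: y_def)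
    have ycoord: "\<bar>y k $ j\<bar> = \<bar>x k $ j\<bar> / M k" if "j < n" for j k
      using that x[of k] Mpos[of k] by (simp add: y_def abs_mult)
    have yle: "\<bar>y k $ j\<bar> \<le> 1" if "j < n" for j k
      using that M Mpos[of k] by (simp add: ycoord)
    \<comment> \<open>The coordinate of absolute value 1 may change with \<open>k\<close>; the sum
      over all coordinates does not refer to it and passes to the limit.\<close>
    have ymax: "1 \<le> (\<Sum>j<n. \<bar>y k $ j\<bar>)" for k
    proof -
      have "M k \<in> (\<lambda>i. \<bar>x k $ i\<bar>) ` {..<n}"
        unfolding M_def using n by (intro Max_in) auto
      then obtain j where j: "j < n" "M k = \<bar>x k $ j\<bar>" by auto
      then have "1 = \<bar>y k $ j\<bar>" using ycoord[OF j(1), of k] Mpos[of k] by simp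
      also have "\<dots> \<le> (\<Sum>j<n. \<bar>y k $ j\<bar>)" using j by (intro member_le_sum) auto
      finally show ?thesis .
    qed
    have yN: "N (y k) \<le> inverse (real (Suc k))" for k
    proof -
      have "real (Suc k) * N (x k) \<le> M k" using lt[of k] M[OF i[of k], of k] by linarith
      then show ?thesis
        using Mpos[of k] vector_norm_smult[OF N x] by (simp add: y_def field_simps)
    qed
    obtain r where r: "strict_mono r" and conv: "\<forall>j<n. convergent (\<lambda>k. y (r k) $ j)"
      using bounded_coordinates_convergent_subseq[of n "\<lambda>k j. y k $ j" 1] yle by blast
    define z where "z = vec n (\<lambda>j. lim (\<lambda>k. y (r k) $ j))"
    have z: "z \<in> carrier_vec n" by (simp add: z_def)
    have lim: "(\<lambda>k. y (r k) $ j) \<longlonglongrightarrow> z $ j" if "j < n" for j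
      using conv that by (simp add: z_def convergent_LIMSEQ_iff)
    \<comment> \<open>Splitting \<open>z\<close> into \<open>y (r k)\<close> and the remainder plays
      the role of continuity of \<open>N\<close>: both summands tend to 0.\<close>
    have bound: "N z \<le> inverse (real (Suc (r k))) + (\<Sum>j<n. \<bar>z $ j - y (r k) $ j\<bar> * N (unit_vec n j))"
      for k
    proof -
      have d: "z - y (r k) \<in> carrier_vec n" using z y by simp
      have "z = y (r k) + (z - y (r k))" using z y[of "r k"] by (intro eq_vecI) auto
      then have "N z \<le> N (y (r k)) + N (z - y (r k))"
        using vector_norm_triangle[OF N y d] by metis
      moreover have "(\<Sum>j<n. \<bar>(z - y (r k)) $ j\<bar> * N (unit_vec n j))
          = (\<Sum>j<n. \<bar>z $ j - y (r k) $ j\<bar> * N (unit_vec n j))"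
        using z y[of "r k"] by (intro sum.cong) auto
      ultimately show ?thesis
        using vector_norm_le_coordinates[OF N d] yN[of "r k"] by linarith
    qed
    have "(\<lambda>k. inverse (real (Suc (r k)))) \<longlonglongrightarrow> 0"
      using LIMSEQ_subseq_LIMSEQ[OF LIMSEQ_inverse_real_of_nat r] by (simp add: o_def)
    moreover have "(\<lambda>k. \<Sum>j<n. \<bar>z $ j - y (r k) $ j\<bar> * N (unit_vec n j))
        \<longlonglongrightarrow> (\<Sum>j<n. \<bar>z $ j - z $ j\<bar> * N (unit_vec n j))"
      using lim by (intro tendsto_intros) auto
    ultimately have "(\<lambda>k. inverse (real (Suc (r k)))
        + (\<Sum>j<n. \<bar>z $ j - y (r k) $ j\<bar> * N (unit_vec n j))) \<longlonglongrightarrow> 0"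
      using tendsto_add by fastforce
    then have "N z \<le> 0" using bound by (intro LIMSEQ_le_const) auto
    then have "z = 0\<^sub>v n"
      using vector_norm_ge_0[OF N z] vector_norm_eq_0[OF N z] by simp
    then have z0: "\<And>j. j < n \<Longrightarrow> z $ j = 0" by simp
    have "(\<lambda>k. \<Sum>j<n. \<bar>y (r k) $ j\<bar>) \<longlonglongrightarrow> (\<Sum>j<n. \<bar>z $ j\<bar>)"
      using lim by (intro tendsto_intros) auto
    then have "1 \<le> (\<Sum>j<n. \<bar>z $ j\<bar>)" using ymax by (intro LIMSEQ_le_const) auto
    then show False using z0 by simp
  qed
  then show thesis by (meson that of_nat_0_less_iff zero_less_Suc)
qed

section \<open>Induced norm and diameter compared with matrix entries\<close>

lemma abs_mult_mat_vec_le: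
  fixes A :: "real mat" and x :: "real vec"
  assumes "A \<in> carrier_mat n k" "x \<in> carrier_vec k" "i < n" "0 \<le> a"
    and "\<And>j. j < k \<Longrightarrow> \<bar>A $$ (i, j)\<bar> \<le> a" "\<And>j. j < k \<Longrightarrow> \<bar>x $ j\<bar> \<le> b"
  shows "\<bar>(A *\<^sub>v x) $ i\<bar> \<le> real k * a * b"
proof -
  have "(A *\<^sub>v x) $ i = (\<Sum>j<k. A $$ (i, j) * x $ j)"
    using assms(1-3) by (simp add: scalar_prod_def lessThan_atLeast0)
  also have "\<bar>\<dots>\<bar> \<le> (\<Sum>j<k. a * b)"
    using assms(4-6) by (intro order.trans[OF sum_abs] sum_mono) (auto simp: abs_mult intro!: mult_mono)
  finally show ?thesis by simp
qed

lemma abs_mult_mat_le: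
  fixes A B :: "real mat"
  assumes "A \<in> carrier_mat n k" "B \<in> carrier_mat k l" "i < n" "j < l" "0 \<le> a"
    and "\<And>p. p < k \<Longrightarrow> \<bar>A $$ (i, p)\<bar> \<le> a" "\<And>p. p < k \<Longrightarrow> \<bar>B $$ (p, j)\<bar> \<le> b"
  shows "\<bar>(A * B) $$ (i, j)\<bar> \<le> real k * a * b"
  using abs_mult_mat_vec_le[of A n k "col B j" i a b] assms by simp

lemma mat_entries_bounded:
  fixes A :: "real mat"
  assumes "A \<in> carrier_mat n k"
  obtains a where "0 < a" "\<And>i j. i < n \<Longrightarrow> j < k \<Longrightarrow> \<bar>A $$ (i, j)\<bar> \<le> a"
proof
  let ?S = "\<Sum>(i, j)\<in>{..<n} \<times> {..<k}. \<bar>A $$ (i, j)\<bar>"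
  show "0 < ?S + 1" by (intro add_nonneg_pos sum_nonneg) auto
  fix i j assume "i < n" "j < k"
  then have "\<bar>A $$ (i, j)\<bar> \<le> ?S"
    using member_le_sum[of "(i, j)" "{..<n} \<times> {..<k}" "\<lambda>(i, j). \<bar>A $$ (i, j)\<bar>"] by auto
  then show "\<bar>A $$ (i, j)\<bar> \<le> ?S + 1" by simp
qed

text \<open>Vectors in the unit ball have bounded coordinates, which bounds the norm from above;
  conversely, rescaled unit vectors lie in the ball and detect the columns of
  \<open>A\<close>.\<close>

lemma induced_matrix_norm_entries:
  assumes N: "vector_norm n N"
  obtains c where "0 < c"
    and "\<And>A. A \<in> carrier_mat n n \<Longrightarrow> 0 \<le> induced_matrix_norm n N A"
    and "\<And>A i j. A \<in> carrier_mat n n \<Longrightarrow> i < n \<Longrightarrow> j < n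
      \<Longrightarrow> \<bar>A $$ (i, j)\<bar> \<le> c * induced_matrix_norm n N A"
    and "\<And>A b. A \<in> carrier_mat n n \<Longrightarrow> 0 \<le> b \<Longrightarrow> (\<And>i j. i < n \<Longrightarrow> j < n \<Longrightarrow> \<bar>A $$ (i, j)\<bar> \<le> b)
      \<Longrightarrow> induced_matrix_norm n N A \<le> c * b"
proof -
  obtain u where u: "0 < u"
    "\<And>x b. x \<in> carrier_vec n \<Longrightarrow> 0 \<le> b \<Longrightarrow> (\<And>i. i < n \<Longrightarrow> \<bar>x $ i\<bar> \<le> b) \<Longrightarrow> N x \<le> u * b"
    using vector_norm_upper_bound[OF N] by blast
  obtain l where l: "0 < l" "\<And>x i. x \<in> carrier_vec n \<Longrightarrow> i < n \<Longrightarrow> \<bar>x $ i\<bar> \<le> l * N x"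
    using vector_norm_coordinate_bound[OF N] by blast
  let ?B = "{x \<in> carrier_vec n. N x \<le> 1}"
  have z: "0\<^sub>v n \<in> ?B" using vector_norm_eq_0[OF N, of "0\<^sub>v n"] by simp
  have ball: "N (A *\<^sub>v x) \<le> u * real n * l * b"
    if A: "A \<in> carrier_mat n n" and b: "0 \<le> b" "\<And>i j. i < n \<Longrightarrow> j < n \<Longrightarrow> \<bar>A $$ (i, j)\<bar> \<le> b"
      and x: "x \<in> ?B" for A x b
  proof -
    have "\<bar>x $ i\<bar> \<le> l" if "i < n" for i
    proof -
      have "\<bar>x $ i\<bar> \<le> l * N x" using l(2) x that by simp
      also have "\<dots> \<le> l" using x l(1) by simp
      finally show ?thesis .
    qed
    then have "\<bar>(A *\<^sub>v x) $ i\<bar> \<le> real n * b * l" if "i < n" for i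
      using A x b that by (intro abs_mult_mat_vec_le[of A n n x]) auto
    then have "N (A *\<^sub>v x) \<le> u * (real n * b * l)"
      using A x b l(1) by (intro u(2)) auto
    then show ?thesis by (simp add: mult_ac)
  qed
  have upper: "induced_matrix_norm n N A \<le> u * real n * l * b"
    if "A \<in> carrier_mat n n" "0 \<le> b" "\<And>i j. i < n \<Longrightarrow> j < n \<Longrightarrow> \<bar>A $$ (i, j)\<bar> \<le> b" for A b
    unfolding induced_matrix_norm_def using z ball[OF that] by (intro cSUP_least) blast+
  have point: "N (A *\<^sub>v x) \<le> induced_matrix_norm n N A"
    if A: "A \<in> carrier_mat n n" and x: "x \<in> ?B" for A x
  proof -
    obtain a where "0 < a" "\<And>i j. i < n \<Longrightarrow> j < n \<Longrightarrow> \<bar>A $$ (i, j)\<bar> \<le> a"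
      using mat_entries_bounded[OF A] by blast
    \<comment> \<open>Boundedness makes the real \<open>SUP\<close> a genuine supremum, so that it
      dominates each value.\<close>
    then have "bdd_above ((\<lambda>x. N (A *\<^sub>v x)) ` ?B)"
      using ball[OF A, of a] by (intro bdd_aboveI2[of _ _ "u * real n * l * a"]) auto
    then show ?thesis
      unfolding induced_matrix_norm_def using x by (intro cSUP_upper)
  qed
  have nonneg: "0 \<le> induced_matrix_norm n N A" if A: "A \<in> carrier_mat n n" for A
    using vector_norm_ge_0[OF N, of "A *\<^sub>v 0\<^sub>v n"] point[OF A z] A by simp
  have lower: "\<bar>A $$ (i, j)\<bar> \<le> l * u * induced_matrix_norm n N A"
    if A: "A \<in> carrier_mat n n" and ij: "i < n" "j < n" for A i j
  proof -
    \<comment> \<open>\<open>u\<close> bounds the norm of every unit vector, so the factor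
      \<open>1 / u\<close> moves it into the unit ball.\<close>
    let ?x = "(1 / u) \<cdot>\<^sub>v unit_vec n j"
    have x: "?x \<in> carrier_vec n" by simp
    have "N ?x \<le> u * (1 / u)"
      using u(1) by (intro u(2)[OF x]) (auto simp: unit_vec_def)
    then have "?x \<in> ?B" using u(1) by simp
    then have "N (A *\<^sub>v ?x) \<le> induced_matrix_norm n N A" using point[OF A] by blast
    moreover have "A *\<^sub>v unit_vec n j = col A j"
      using A ij by (intro eq_vecI) auto
    then have "A *\<^sub>v ?x = (1 / u) \<cdot>\<^sub>v col A j"
      using mult_mat_vec[OF A, of "unit_vec n j" "1 / u"] by simp
    moreover have "col A j \<in> carrier_vec n" using A ij by auto
    ultimately have "N (col A j) \<le> u * induced_matrix_norm n N A"
      using u(1) vector_norm_smult[OF N, of "col A j" "1 / u"] by (simp add: field_simps)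
    then have "l * N (col A j) \<le> l * (u * induced_matrix_norm n N A)" using l(1) by simp
    moreover have "\<bar>col A j $ i\<bar> \<le> l * N (col A j)" using A ij by (intro l(2)) auto
    ultimately show ?thesis using A ij by (simp add: mult.assoc)
  qed
  define c where "c = l * u + u * real n * l"
  have c: "0 < c" "l * u \<le> c" "u * real n * l \<le> c"
    using l(1) u(1) by (auto simp: c_def add_pos_nonneg)
  show thesis
  proof (rule that[OF c(1) nonneg])
    fix A :: "real mat" and i j assume A: "A \<in> carrier_mat n n" and "i < n" "j < n"
    then show "\<bar>A $$ (i, j)\<bar> \<le> c * induced_matrix_norm n N A"
      using lower[of A i j] mult_right_mono[OF c(2) nonneg[OF A]] by linarith
  next
    fix A :: "real mat" and b :: real assume A: "A \<in> carrier_mat n n" and b: "0 \<le> b"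
      and "\<And>i j. i < n \<Longrightarrow> j < n \<Longrightarrow> \<bar>A $$ (i, j)\<bar> \<le> b"
    then have "induced_matrix_norm n N A \<le> u * real n * l * b" using upper by blast
    then show "induced_matrix_norm n N A \<le> c * b"
      using mult_right_mono[OF c(3) b] by linarith
  qed
qed

text \<open>Norm equivalence applied to the differences of rows. The hypothesis
  \<open>1 \<le> m\<close> makes the set under \<open>Max\<close> nonempty.\<close>

lemma mat_diam_entries:
  assumes N: "vector_norm m N" and m: "1 \<le> m"
  obtains c where "0 < c"
    and "\<And>A. A \<in> carrier_mat m m \<Longrightarrow> 0 \<le> mat_diam N A"
    and "\<And>A i j k. A \<in> carrier_mat m m \<Longrightarrow> i < m \<Longrightarrow> j < m \<Longrightarrow> k < m
      \<Longrightarrow> \<bar>A $$ (i, k) - A $$ (j, k)\<bar> \<le> c * mat_diam N A"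
    and "\<And>A b. A \<in> carrier_mat m m \<Longrightarrow> 0 \<le> b
      \<Longrightarrow> (\<And>i j k. i < m \<Longrightarrow> j < m \<Longrightarrow> k < m \<Longrightarrow> \<bar>A $$ (i, k) - A $$ (j, k)\<bar> \<le> b)
      \<Longrightarrow> mat_diam N A \<le> c * b"
proof -
  obtain u where u: "0 < u"
    "\<And>x b. x \<in> carrier_vec m \<Longrightarrow> 0 \<le> b \<Longrightarrow> (\<And>i. i < m \<Longrightarrow> \<bar>x $ i\<bar> \<le> b) \<Longrightarrow> N x \<le> u * b"
    using vector_norm_upper_bound[OF N] by blast
  obtain l where l: "0 < l" "\<And>x i. x \<in> carrier_vec m \<Longrightarrow> i < m \<Longrightarrow> \<bar>x $ i\<bar> \<le> l * N x"
    using vector_norm_coordinate_bound[OF N] by blast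
  have diff: "N (row A i - row A j) \<le> mat_diam N A"
    if "A \<in> carrier_mat m m" "i < m" "j < m" for A i j
    unfolding mat_diam_def using that by (intro Max_ge) auto
  have row: "row A i \<in> carrier_vec m" if "A \<in> carrier_mat m m" for A :: "real mat" and i
    using that by auto
  have nonneg: "0 \<le> mat_diam N A" if A: "A \<in> carrier_mat m m" for A
    using vector_norm_ge_0[OF N, of "row A 0 - row A 0"] diff[OF A, of 0 0] row[OF A] m by simp
  have lower: "\<bar>A $$ (i, k) - A $$ (j, k)\<bar> \<le> l * mat_diam N A"
    if A: "A \<in> carrier_mat m m" and ijk: "i < m" "j < m" "k < m" for A i j k
  proof -
    have "\<bar>(row A i - row A j) $ k\<bar> \<le> l * N (row A i - row A j)"
      using row[OF A] ijk by (intro l(2)) auto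
    also have "\<dots> \<le> l * mat_diam N A" using diff[OF A ijk(1,2)] l(1) by simp
    finally show ?thesis using A ijk by simp
  qed
  have upper: "mat_diam N A \<le> u * b"
    if A: "A \<in> carrier_mat m m" and b: "0 \<le> b"
      "\<And>i j k. i < m \<Longrightarrow> j < m \<Longrightarrow> k < m \<Longrightarrow> \<bar>A $$ (i, k) - A $$ (j, k)\<bar> \<le> b" for A b
  proof -
    have "N (row A i - row A j) \<le> u * b" if "i < m" "j < m" for i j
      using A b that by (intro u(2)) auto
    then show ?thesis
      unfolding mat_diam_def using A m by (subst Max_le_iff) (auto simp: lessThan_empty_iff)
  qed
  show thesis
  proof (rule that[of "l + u", OF _ nonneg])
    show "0 < l + u" using l(1) u(1) by simp
  next
    fix A :: "real mat" and i j k assume A: "A \<in> carrier_mat m m" and "i < m" "j < m" "k < m"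
    then have "\<bar>A $$ (i, k) - A $$ (j, k)\<bar> \<le> l * mat_diam N A" using lower by blast
    also have "\<dots> \<le> (l + u) * mat_diam N A" using u(1) nonneg[OF A] by (intro mult_right_mono) auto
    finally show "\<bar>A $$ (i, k) - A $$ (j, k)\<bar> \<le> (l + u) * mat_diam N A" .
  next
    fix A :: "real mat" and b :: real assume A: "A \<in> carrier_mat m m" and b: "0 \<le> b"
      and "\<And>i j k. i < m \<Longrightarrow> j < m \<Longrightarrow> k < m \<Longrightarrow> \<bar>A $$ (i, k) - A $$ (j, k)\<bar> \<le> b"
    then have "mat_diam N A \<le> u * b" using upper by blast
    also have "\<dots> \<le> (l + u) * b" using l(1) b by (intro mult_right_mono) auto
    finally show "mat_diam N A \<le> (l + u) * b" .
  qed
qed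

section \<open>The kernel of \<open>P\<close> and its right inverse\<close>

lemma sync_projection_kernel:
  assumes "sync_projection m P"
  shows "P \<in> carrier_mat (m - 1) m" "mat_kernel P = {c \<cdot>\<^sub>v ones_vec m | c. True}"
  using assms synchronization_space_eq[of m] by (auto simp: sync_projection_def)

text \<open>The sum is the product of a row of \<open>P\<close> with the kernel vector
  \<open>ones_vec m\<close>. Hence subtracting the same vector from all rows of \<open>A\<close>
  leaves \<open>P * A\<close> unchanged.\<close>

lemma sync_projection_row_sum:
  assumes P: "sync_projection m P" and i: "i < m - 1"
  shows "(\<Sum>k<m. P $$ (i, k)) = 0"
proof -
  note Pc = sync_projection_kernel(1)[OF P]
  have "ones_vec m = 1 \<cdot>\<^sub>v ones_vec m" by simp
  then have "ones_vec m \<in> mat_kernel P" using sync_projection_kernel(2)[OF P] by blast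
  then have "P *\<^sub>v ones_vec m = 0\<^sub>v (m - 1)" using mat_kernelD[OF Pc] by blast
  from arg_cong[OF this, of "\<lambda>v. v $ i"] show ?thesis
    using i Pc by (simp add: ones_vec_def scalar_prod_def lessThan_atLeast0)
qed

text \<open>\<open>Q * P\<close> differs from the identity only by multiples of \<open>ones_vec m\<close>, so it preserves
  differences of coordinates.\<close>

lemma sync_projection_coordinate_diff:
  assumes P: "sync_projection m P"
    and Q: "Q \<in> carrier_mat m (m - 1)" "P * Q = 1\<^sub>m (m - 1)"
    and X: "X \<in> carrier_mat m l" and ijk: "i < m" "j < m" "k < l"
  shows "X $$ (i, k) - X $$ (j, k) = (Q * (P * X)) $$ (i, k) - (Q * (P * X)) $$ (j, k)"
proof -
  note Pc = sync_projection_kernel(1)[OF P]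
  let ?v = "col (Q * (P * X)) k - col X k"
  have PX: "P * X \<in> carrier_mat (m - 1) l" using Pc X by simp
  have QPX: "Q * (P * X) \<in> carrier_mat m l" using Q PX by simp
  have c: "col (Q * (P * X)) k \<in> carrier_vec m" "col X k \<in> carrier_vec m"
    using col_dim[of "Q * (P * X)" k] col_dim[of X k]
    unfolding carrier_matD(1)[OF QPX] carrier_matD(1)[OF X] .
  \<comment> \<open>By \<open>P * Q = 1\<close>, the two columns have the same image under
    \<open>P\<close>; their difference is therefore a constant vector, which cancels between
    coordinates \<open>i\<close> and \<open>j\<close>.\<close>
  have "P * (Q * (P * X)) = P * X"
    by (rule assoc_mult_mat[OF Pc Q(1) PX, unfolded Q(2) left_mult_one_mat[OF PX], symmetric])
  then have "P *\<^sub>v col (Q * (P * X)) k = P *\<^sub>v col X k"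
    using col_mult2[OF Pc QPX ijk(3)] col_mult2[OF Pc X ijk(3)] by simp
  then have "P *\<^sub>v ?v = 0\<^sub>v (m - 1)"
    using mult_minus_distrib_mat_vec[OF Pc c]
      minus_cancel_vec[OF mult_mat_vec_carrier[OF Pc c(2)]] by simp
  then have "?v \<in> mat_kernel P" using c by (intro mat_kernelI[OF Pc]) auto
  then obtain a where a: "?v = a \<cdot>\<^sub>v ones_vec m" using sync_projection_kernel(2)[OF P] by auto
  have "(Q * (P * X)) $$ (p, k) - X $$ (p, k) = a" if "p < m" for p
    using arg_cong[OF a, of "\<lambda>v. v $ p"] that QPX X Q(1) Pc ijk(3) by (simp add: ones_vec_def)
  from this[OF ijk(1)] this[OF ijk(2)] show ?thesis by linarith
qed

section \<open>Skew projections of products\<close>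

lemma skew_projection:
  assumes "1 \<le> m" "sync_projection m P" "A \<in> equal_row_sum_mats m"
  shows "skew_projection m P A \<in> carrier_mat (m - 1) (m - 1)" "P * A = skew_projection m P A * P"
  using theI'[OF skew_projection_ex1[OF assms]] unfolding skew_projection_def by auto

lemma left_mat_prod_carrier:
  assumes "\<And>k. k < t \<Longrightarrow> A (a + k) \<in> carrier_mat n n"
  shows "left_mat_prod n A a t \<in> carrier_mat n n"
  using assms by (induction t) (auto intro: mult_carrier_mat[of _ n n])

text \<open>\<open>P\<close> is moved past the factors one at a time, turning each
  \<open>A (a + k)\<close> into \<open>B (a + k)\<close>.\<close>

lemma left_mat_prod_intertwine:
  assumes P: "P \<in> carrier_mat n m"
    and A: "\<And>k. k < t \<Longrightarrow> A (a + k) \<in> carrier_mat m m"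
    and B: "\<And>k. k < t \<Longrightarrow> B (a + k) \<in> carrier_mat n n"
    and PA: "\<And>k. k < t \<Longrightarrow> P * A (a + k) = B (a + k) * P"
  shows "P * left_mat_prod m A a t = left_mat_prod n B a t * P"
  using A B PA
proof (induction t)
  case 0
  then show ?case using P by simp
next
  case (Suc t)
  let ?A = "left_mat_prod m A a t" and ?B = "left_mat_prod n B a t"
  have c: "?A \<in> carrier_mat m m" "?B \<in> carrier_mat n n"
    using Suc.prems by (auto intro!: left_mat_prod_carrier)
  have At: "A (a + t) \<in> carrier_mat m m" and Bt: "B (a + t) \<in> carrier_mat n n"
    using Suc.prems by auto
  have "P * (A (a + t) * ?A) = B (a + t) * P * ?A"
    using assoc_mult_mat[OF P At c(1)] Suc.prems by simp
  also have "\<dots> = B (a + t) * (?B * P)"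
    using assoc_mult_mat[OF Bt P c(1)] Suc by simp
  also have "\<dots> = B (a + t) * ?B * P"
    using assoc_mult_mat[OF Bt c(2) P] by simp
  finally show ?case by simp
qed

section \<open>Comparison of diameter and projected norm\<close>

text \<open>The order of quantifiers matters: \<open>c\<close> is chosen before the pair
  \<open>A\<close>, \<open>B\<close>, so one constant serves the products for all \<open>t\<close>
  and \<open>t\<^sub>0\<close>.\<close>

lemma mat_diam_induced_norm_equivalent:
  assumes m: "1 \<le> m" and P: "sync_projection m P"
    and N: "vector_norm m N" and N': "vector_norm (m - 1) N'"
  obtains c where "0 < c"
    and "\<And>A B. A \<in> carrier_mat m m \<Longrightarrow> B \<in> carrier_mat (m - 1) (m - 1) \<Longrightarrow> P * A = B * P \<Longrightarrow>
      0 \<le> mat_diam N A \<and> 0 \<le> induced_matrix_norm (m - 1) N' B \<and>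
      mat_diam N A \<le> c * induced_matrix_norm (m - 1) N' B \<and>
      induced_matrix_norm (m - 1) N' B \<le> c * mat_diam N A"
proof -
  note Pc = sync_projection_kernel(1)[OF P]
  obtain Q where Q: "Q \<in> carrier_mat m (m - 1)" "P * Q = 1\<^sub>m (m - 1)"
    using sync_projection_right_inverse[OF m P] .
  obtain d where d: "0 < d"
    and dpos: "\<And>A. A \<in> carrier_mat m m \<Longrightarrow> 0 \<le> mat_diam N A"
    and dlow: "\<And>A i j k. A \<in> carrier_mat m m \<Longrightarrow> i < m \<Longrightarrow> j < m \<Longrightarrow> k < m
      \<Longrightarrow> \<bar>A $$ (i, k) - A $$ (j, k)\<bar> \<le> d * mat_diam N A"
    and dup: "\<And>A b. A \<in> carrier_mat m m \<Longrightarrow> 0 \<le> b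
      \<Longrightarrow> (\<And>i j k. i < m \<Longrightarrow> j < m \<Longrightarrow> k < m \<Longrightarrow> \<bar>A $$ (i, k) - A $$ (j, k)\<bar> \<le> b)
      \<Longrightarrow> mat_diam N A \<le> d * b"
    using mat_diam_entries[OF N m] by blast
  let ?I = "induced_matrix_norm (m - 1) N'"
  obtain e where e: "0 < e"
    and epos: "\<And>A. A \<in> carrier_mat (m - 1) (m - 1) \<Longrightarrow> 0 \<le> ?I A"
    and elow: "\<And>A i j. A \<in> carrier_mat (m - 1) (m - 1) \<Longrightarrow> i < m - 1 \<Longrightarrow> j < m - 1
      \<Longrightarrow> \<bar>A $$ (i, j)\<bar> \<le> e * ?I A"
    and eup: "\<And>A b. A \<in> carrier_mat (m - 1) (m - 1) \<Longrightarrow> 0 \<le> b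
      \<Longrightarrow> (\<And>i j. i < m - 1 \<Longrightarrow> j < m - 1 \<Longrightarrow> \<bar>A $$ (i, j)\<bar> \<le> b) \<Longrightarrow> ?I A \<le> e * b"
    using induced_matrix_norm_entries[OF N'] by blast
  obtain p where p: "0 < p" "\<And>i j. i < m - 1 \<Longrightarrow> j < m \<Longrightarrow> \<bar>P $$ (i, j)\<bar> \<le> p"
    using mat_entries_bounded[OF Pc] by blast
  obtain q where q: "0 < q" "\<And>i j. i < m \<Longrightarrow> j < m - 1 \<Longrightarrow> \<bar>Q $$ (i, j)\<bar> \<le> q"
    using mat_entries_bounded[OF Q(1)] by blast
  define r where "r = real (m - 1)"
  define s where "s = real m"
  have rs: "0 \<le> r" "0 \<le> s" by (simp_all add: r_def s_def)
  \<comment> \<open>In \<open>c1\<close>, the factor \<open>r * e * p\<close> comes from the entries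
    of \<open>B * P\<close>, \<open>r * q\<close> from multiplication by \<open>Q\<close>, 2 from a
    difference of two entries and \<open>d\<close> from the passage to the diameter. In
    \<open>c2\<close>, \<open>s * p * d\<close> bounds the entries of \<open>P * A\<close>,
    \<open>s\<close> and \<open>q\<close> come from multiplication by \<open>Q\<close> and
    \<open>e\<close> from the passage to the norm.\<close>
  define c1 where "c1 = d * (2 * (r * q * (r * e * p)))"
  define c2 where "c2 = e * (s * (s * p * d) * q)"
  have c12: "0 \<le> c1" "0 \<le> c2" using rs d e p q by (auto simp: c1_def c2_def)
  have diam_le: "mat_diam N A \<le> c1 * ?I B"
    if A: "A \<in> carrier_mat m m" and B: "B \<in> carrier_mat (m - 1) (m - 1)" and PA: "P * A = B * P" for A B
  proof -
    let ?b = "r * (e * ?I B) * p"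
    have I: "0 \<le> ?I B" using epos[OF B] .
    have BP: "B * P \<in> carrier_mat (m - 1) m" using B Pc by simp
    have bp: "\<bar>(B * P) $$ (i, j)\<bar> \<le> ?b" if "i < m - 1" "j < m" for i j
      unfolding r_def using that I e by (intro abs_mult_mat_le[OF B Pc] elow[OF B] p(2)) auto
    have qbp: "\<bar>(Q * (B * P)) $$ (i, j)\<bar> \<le> r * q * ?b" if "i < m" "j < m" for i j
      using that q(1)
      by (intro abs_mult_mat_le[OF Q(1) BP, folded r_def] q(2) bp) auto
    have "\<bar>A $$ (i, k) - A $$ (j, k)\<bar> \<le> 2 * (r * q * ?b)" if "i < m" "j < m" "k < m" for i j k
      using sync_projection_coordinate_diff[OF P Q A that] qbp[of i k] qbp[of j k] that
      unfolding PA by linarith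
    then have "mat_diam N A \<le> d * (2 * (r * q * ?b))"
      using I e p(1) q(1) rs by (intro dup[OF A]) auto
    then show ?thesis by (simp add: c1_def mult_ac)
  qed
  have norm_le: "?I B \<le> c2 * mat_diam N A"
    if A: "A \<in> carrier_mat m m" and B: "B \<in> carrier_mat (m - 1) (m - 1)" and PA: "P * A = B * P" for A B
  proof -
    let ?a = "d * mat_diam N A"
    have D: "0 \<le> mat_diam N A" using dpos[OF A] .
    have PAc: "P * A \<in> carrier_mat (m - 1) m" using A Pc by simp
    have pa: "\<bar>(P * A) $$ (i, k)\<bar> \<le> s * p * ?a" if ik: "i < m - 1" "k < m" for i k
    proof -
      have "(P * A) $$ (i, k) = (\<Sum>j<m. P $$ (i, j) * A $$ (j, k))"
        using ik A Pc by (simp add: scalar_prod_def lessThan_atLeast0)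
      \<comment> \<open>Row 0 of \<open>A\<close> is subtracted from every row, at no cost because
        row \<open>i\<close> of \<open>P\<close> sums to 0; only differences controlled by the
        diameter remain.\<close>
      also have "\<dots> = (\<Sum>j<m. P $$ (i, j) * (A $$ (j, k) - A $$ (0, k)))"
        using sync_projection_row_sum[OF P ik(1)]
        by (simp add: right_diff_distrib sum_subtractf sum_distrib_right[symmetric])
      also have "\<bar>\<dots>\<bar> \<le> (\<Sum>j<m. p * ?a)"
        using ik m p dlow[OF A]
        by (intro order.trans[OF sum_abs] sum_mono) (auto simp: abs_mult intro!: mult_mono)
      finally show ?thesis by (simp add: s_def)
    qed
    have "B = P * A * Q"
      using assoc_mult_mat[OF B Pc Q(1)] PA Q(2) B by simp
    then have "\<bar>B $$ (i, j)\<bar> \<le> s * (s * p * ?a) * q" if "i < m - 1" "j < m - 1" for i j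
      using that rs p(1) d D abs_mult_mat_le[OF PAc Q(1) that, of "s * p * ?a" q] pa q(2)
      by (simp add: s_def)
    then have "?I B \<le> e * (s * (s * p * ?a) * q)"
      using rs p(1) d D q(1) by (intro eup[OF B]) auto
    then show ?thesis by (simp add: c2_def mult_ac)
  qed
  show thesis
  \<comment> \<open>The sum dominates both constants, and the summand 1 keeps it positive: for
    \<open>m = 1\<close>, \<open>c1\<close> is 0.\<close>
  proof (rule that[of "c1 + c2 + 1"], goal_cases)
    case 1
    show ?case using c12 by simp
  next
    case (2 A B)
    have "c1 * ?I B \<le> (c1 + c2 + 1) * ?I B" "c2 * mat_diam N A \<le> (c1 + c2 + 1) * mat_diam N A"
      using c12 dpos[OF 2(1)] epos[OF 2(2)] by (auto intro!: mult_right_mono)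
    then show ?case
      using dpos[OF 2(1)] epos[OF 2(2)] diam_le[OF 2] norm_le[OF 2] by linarith
  qed
qed

section \<open>Equality of the projection joint spectral radius and the Hajnal diameter\<close>

theorem lemma2:
  fixes \<Phi> :: "'s set"
    and \<rho> :: "nat \<Rightarrow> 's \<Rightarrow> 's"
    and m :: nat
    and L :: "nat \<Rightarrow> 's \<Rightarrow> real mat"
    and P :: "real mat"
    and N N' :: "real vec \<Rightarrow> real"
    and \<phi> :: 's
  assumes "1 \<le> m"
    and "semiflow_on \<Phi> \<rho>"
    and "\<And>t \<psi>. \<psi> \<in> \<Phi> \<Longrightarrow> L t \<psi> \<in> carrier_mat m m"
    and "\<And>t\<^sub>0 \<psi>. \<psi> \<in> \<Phi> \<Longrightarrow> range (mat_seq_map L \<rho> t\<^sub>0 \<psi>) \<subseteq> equal_row_sum_mats m"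
    and "vector_norm m N"
    and "sync_projection m P"
    and "vector_norm (m - 1) N'"
    and "\<phi> \<in> \<Phi>"
  shows "projection_jsr m P N' L \<rho> \<phi> = hajnal_diameter m N L \<rho> \<phi>"
proof -
  \<comment> \<open>The product starting at \<open>t\<^sub>0\<close> uses only indices
    \<open>t\<^sub>0 + k\<close>, where the natural subtraction gives exactly
    \<open>k\<close>.\<close>
  define A where "A t\<^sub>0 k = L k (\<rho> (k - t\<^sub>0) \<phi>)" for t\<^sub>0 k
  have H: "A t\<^sub>0 (t\<^sub>0 + k) \<in> equal_row_sum_mats m" for t\<^sub>0 k
  proof -
    have "A t\<^sub>0 (t\<^sub>0 + k) = mat_seq_map L \<rho> t\<^sub>0 \<phi> k"
      by (simp add: A_def mat_seq_map_def add.commute)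
    then show ?thesis using assms(4)[OF assms(8)] by auto
  qed
  then have Ac: "A t\<^sub>0 (t\<^sub>0 + k) \<in> carrier_mat m m" for t\<^sub>0 k
    unfolding equal_row_sum_mats_def by blast
  note B = skew_projection[OF assms(1,6) H]
  let ?A = "\<lambda>t t\<^sub>0. left_mat_prod m (A t\<^sub>0) t\<^sub>0 t"
  let ?B = "\<lambda>t t\<^sub>0. left_mat_prod (m - 1) (\<lambda>k. skew_projection m P (A t\<^sub>0 k)) t\<^sub>0 t"
  obtain c where c: "0 < c"
    and eq: "\<And>A B. A \<in> carrier_mat m m \<Longrightarrow> B \<in> carrier_mat (m - 1) (m - 1) \<Longrightarrow> P * A = B * P \<Longrightarrow>
      0 \<le> mat_diam N A \<and> 0 \<le> induced_matrix_norm (m - 1) N' B \<and>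
      mat_diam N A \<le> c * induced_matrix_norm (m - 1) N' B \<and>
      induced_matrix_norm (m - 1) N' B \<le> c * mat_diam N A"
    using mat_diam_induced_norm_equivalent[OF assms(1,6,5,7)] by blast
  have "P * ?A t t\<^sub>0 = ?B t t\<^sub>0 * P" for t t\<^sub>0
    using sync_projection_kernel(1)[OF assms(6)] Ac B by (intro left_mat_prod_intertwine) auto
  moreover have "?A t t\<^sub>0 \<in> carrier_mat m m" "?B t t\<^sub>0 \<in> carrier_mat (m - 1) (m - 1)" for t t\<^sub>0
    using Ac B(1) by (auto intro!: left_mat_prod_carrier)
  \<comment> \<open>The products form an intertwined pair, so the same \<open>c\<close> works in
    both directions for every \<open>t\<close> and \<open>t\<^sub>0\<close>.\<close>
  ultimately have "0 \<le> mat_diam N (?A t t\<^sub>0)" "0 \<le> induced_matrix_norm (m - 1) N' (?B t t\<^sub>0)"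
      "mat_diam N (?A t t\<^sub>0) \<le> c * induced_matrix_norm (m - 1) N' (?B t t\<^sub>0)"
      "induced_matrix_norm (m - 1) N' (?B t t\<^sub>0) \<le> c * mat_diam N (?A t t\<^sub>0)" for t t\<^sub>0
    using eq by blast+
  then show ?thesis
    unfolding projection_jsr_def hajnal_diameter_def A_def[symmetric]
    by (intro antisym limsup_SUP_powr_mono[OF c])
qed

end
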